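(* Let $(A,\mu,\varepsilon,\alpha_A)$ be a (multiplicative) color non-Hom-associative algebra. Define an even bilinear map $[-,-]:A\otimes A\to A$ and an even trilinear map $[-,-,-]_{\alpha_A}:A\otimes A\otimes A\to A$ by setting, for homogeneous $x,y,z\in A$ (and extending linearly), $$[x,y]:=\mu(x,y)-\varepsilon(x,y)\mu(y,x),\qquad [x,y,z]_{\alpha_A}:=as(x,y,z)=\mu(\mu(x,y),\alpha_A(z))-\mu(\alpha_A(x),\mu(y,z)).$$ Then $(A,[-,-],[-,-,-]_{\alpha_A},\varepsilon,\alpha_A)$ is a multiplicative color Hom-Akivis algebra.
   Context: $\mathbf K$ is a field of characteristic $0$ and $G$ is an abelian group (written additively). For a $G$-graded vector space $V=\bigoplus_{a\in G}V_a$, $\mathcal H(V)$ is the set of homogeneous elements. A linear (or multilinear) map is even if it preserves degrees (the degree of the value is the sum of the degrees of the arguments). A bicharacter is a map $\varepsilon:G\times G\to\mathbf K^*$ with $\varepsilon(a,b)\varepsilon(b,a)=1$, $\varepsilon(a,b+c)=\varepsilon(a,b)\varepsilon(a,c)$, $\varepsilon(a+b,c)=\varepsilon(a,c)\varepsilon(b,c)$. For homogeneous $x,y$ of degrees $a,b$ one writes $\varepsilon(x,y):=\varepsilon(a,b)$. A (multiplicative) color non-Hom-associative algebra is a quadruple $(A,\mu,\varepsilon,\alpha_A)$ where $A$ is a $G$-graded vector space, $\mu:A\otimes A\to A$ is an even bilinear map (not required to be associative or Hom-associative), $\varepsilon$ is a bicharacter, and $\alpha_A:A\to A$ is an even linear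 map with $\alpha_A(\mu(x,y))=\mu(\alpha_A(x),\alpha_A(y))$. A color Hom-Akivis algebra is a quintuple $(A,[-,-],[-,-,-],\varepsilon,\alpha_A)$ consisting of a $G$-graded vector space $A$, a bicharacter $\varepsilon$, an even bilinear map $[-,-]$ that is $\varepsilon$-skew-symmetric ($[x,y]=-\varepsilon(x,y)[y,x]$ for homogeneous $x,y$), an even trilinear map $[-,-,-]$, and an even linear map $\alpha_A:A\to A$ such that for all $x,y,z\in\mathcal H(A)$ $$\oint\varepsilon(z,x)[[x,y],\alpha_A(z)]=\oint\varepsilon(z,x)\big([x,y,z]-\varepsilon(x,y)[y,x,z]\big),$$ where $\oint$ denotes the sum over cyclic permutations of $x,y,z$. It is multiplicative if in addition $\alpha_A([x,y])=[\alpha_A(x),\alpha_A(y)]$ and $\alpha_A([x,y,z])=[\alpha_A(x),\alpha_A(y),\alpha_A(z)]$. *)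

theory Defs
  imports Complex_Main
begin

definition decomposition :: "('g \<Rightarrow> 'a::ab_group_add set) \<Rightarrow> 'a \<Rightarrow> ('g \<Rightarrow> 'a) \<Rightarrow> bool" where
  "decomposition gr x f \<longleftrightarrow>
     (\<forall>a. f a \<in> gr a) \<and> finite {a. f a \<noteq> 0} \<and> x = (\<Sum>a | f a \<noteq> 0. f a)"

text \<open>The grading is a family \<open>gr\<close> of subspaces; the whole type is their (internal) direct sum.\<close>

locale graded_vector_space = vector_space scale
  for scale :: "'k::field_char_0 \<Rightarrow> 'a::ab_group_add \<Rightarrow> 'a" +
  fixes gr :: "'g::ab_group_add \<Rightarrow> 'a set"
  assumes subspace_gr: "subspace (gr a)"
    and direct_sum: "\<exists>!f. decomposition gr x f"

definition component :: "('g \<Rightarrow> 'a::ab_group_add set) \<Rightarrow> 'a \<Rightarrow> 'g \<Rightarrow> 'a" where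
  "component gr x = (THE f. decomposition gr x f)"

locale bicharacter =
  fixes \<epsilon> :: "'g::ab_group_add \<Rightarrow> 'g \<Rightarrow> 'k::field_char_0"
  assumes nonzero: "\<epsilon> a b \<noteq> 0"
    and mult_swap: "\<epsilon> a b * \<epsilon> b a = 1"
    and add_right: "\<epsilon> a (b + c) = \<epsilon> a b * \<epsilon> a c"
    and add_left: "\<epsilon> (a + b) c = \<epsilon> a c * \<epsilon> b c"

definition even_linear where
  "even_linear scale gr f \<longleftrightarrow> Vector_Spaces.linear scale scale f \<and>
     (\<forall>a. \<forall>x\<in>gr a. f x \<in> gr a)"

definition even_bilinear where
  "even_bilinear scale gr f \<longleftrightarrow>
     (\<forall>y. Vector_Spaces.linear scale scale (\<lambda>x. f x y)) \<and>
     (\<forall>x. Vector_Spaces.linear scale scale (\<lambda>y. f x y)) \<and>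
     (\<forall>a b. \<forall>x\<in>gr a. \<forall>y\<in>gr b. f x y \<in> gr (a + b))"

definition even_trilinear where
  "even_trilinear scale gr f \<longleftrightarrow>
     (\<forall>y z. Vector_Spaces.linear scale scale (\<lambda>x. f x y z)) \<and>
     (\<forall>x z. Vector_Spaces.linear scale scale (\<lambda>y. f x y z)) \<and>
     (\<forall>x y. Vector_Spaces.linear scale scale (\<lambda>z. f x y z)) \<and>
     (\<forall>a b c. \<forall>x\<in>gr a. \<forall>y\<in>gr b. \<forall>z\<in>gr c. f x y z \<in> gr (a + b + c))"

locale color_nonHom_associative_algebra =
  graded_vector_space scale gr + bicharacter \<epsilon>
  for scale :: "'k::field_char_0 \<Rightarrow> 'a::ab_group_add \<Rightarrow> 'a"
    and gr :: "'g::ab_group_add \<Rightarrow> 'a set"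
    and \<mu> :: "'a \<Rightarrow> 'a \<Rightarrow> 'a"
    and \<epsilon> :: "'g \<Rightarrow> 'g \<Rightarrow> 'k"
    and \<alpha> :: "'a \<Rightarrow> 'a" +
  assumes mu_even_bilinear: "even_bilinear scale gr \<mu>"
    and alpha_even_linear: "even_linear scale gr \<alpha>"
    and alpha_mu: "\<alpha> (\<mu> x y) = \<mu> (\<alpha> x) (\<alpha> y)"

text \<open>The element \<open>0\<close> is homogeneous of every degree, so the identities quantify over degrees
  \<open>a\<close>, \<open>b\<close>, \<open>c\<close> together with elements of these degrees, and \<open>\<epsilon>\<close> is applied to the degrees.\<close>

locale color_Hom_Akivis_algebra =
  graded_vector_space scale gr + bicharacter \<epsilon>
  for scale :: "'k::field_char_0 \<Rightarrow> 'a::ab_group_add \<Rightarrow> 'a"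
    and gr :: "'g::ab_group_add \<Rightarrow> 'a set"
    and br :: "'a \<Rightarrow> 'a \<Rightarrow> 'a"
    and tr :: "'a \<Rightarrow> 'a \<Rightarrow> 'a \<Rightarrow> 'a"
    and \<epsilon> :: "'g \<Rightarrow> 'g \<Rightarrow> 'k"
    and \<alpha> :: "'a \<Rightarrow> 'a" +
  assumes br_even_bilinear: "even_bilinear scale gr br"
    and br_skew: "x \<in> gr a \<Longrightarrow> y \<in> gr b \<Longrightarrow> br x y = - scale (\<epsilon> a b) (br y x)"
    and tr_even_trilinear: "even_trilinear scale gr tr"
    and alpha_even_linear: "even_linear scale gr \<alpha>"
    and Akivis_identity: "x \<in> gr a \<Longrightarrow> y \<in> gr b \<Longrightarrow> z \<in> gr c \<Longrightarrow>
        scale (\<epsilon> c a) (br (br x y) (\<alpha> z))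
      + scale (\<epsilon> a b) (br (br y z) (\<alpha> x))
      + scale (\<epsilon> b c) (br (br z x) (\<alpha> y))
      = scale (\<epsilon> c a) (tr x y z - scale (\<epsilon> a b) (tr y x z))
      + scale (\<epsilon> a b) (tr y z x - scale (\<epsilon> b c) (tr z y x))
      + scale (\<epsilon> b c) (tr z x y - scale (\<epsilon> c a) (tr x z y))"

locale multiplicative_color_Hom_Akivis_algebra =
  color_Hom_Akivis_algebra scale gr br tr \<epsilon> \<alpha>
  for scale :: "'k::field_char_0 \<Rightarrow> 'a::ab_group_add \<Rightarrow> 'a"
    and gr :: "'g::ab_group_add \<Rightarrow> 'a set"
    and br :: "'a \<Rightarrow> 'a \<Rightarrow> 'a"
    and tr :: "'a \<Rightarrow> 'a \<Rightarrow> 'a \<Rightarrow> 'a"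
    and \<epsilon> :: "'g \<Rightarrow> 'g \<Rightarrow> 'k"
    and \<alpha> :: "'a \<Rightarrow> 'a" +
  assumes alpha_br: "\<alpha> (br x y) = br (\<alpha> x) (\<alpha> y)"
    and alpha_tr: "\<alpha> (tr x y z) = tr (\<alpha> x) (\<alpha> y) (\<alpha> z)"

text \<open>The bracket is given by \<open>\<mu> x y - \<epsilon>(x,y) \<mu> y x\<close> on homogeneous elements and extended
  linearly, i.e. summed over the homogeneous components of both arguments; see
  \<open>color_commutator_homogeneous\<close> below.\<close>

definition color_commutator ::
  "('k \<Rightarrow> 'a \<Rightarrow> 'a) \<Rightarrow> ('g \<Rightarrow> 'a::ab_group_add set) \<Rightarrow> ('a \<Rightarrow> 'a \<Rightarrow> 'a) \<Rightarrow>
   ('g \<Rightarrow> 'g \<Rightarrow> 'k) \<Rightarrow> 'a \<Rightarrow> 'a \<Rightarrow> 'a" where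
  "color_commutator scale gr \<mu> \<epsilon> x y =
     (\<Sum>a | component gr x a \<noteq> 0. \<Sum>b | component gr y b \<noteq> 0.
        \<mu> (component gr x a) (component gr y b)
        - scale (\<epsilon> a b) (\<mu> (component gr y b) (component gr x a)))"

text \<open>No \<open>\<epsilon>\<close> occurs in the Hom-associator, so the formula is trilinear as it stands and is its own
  linear extension from homogeneous elements.\<close>

definition Hom_associator ::
  "('a::ab_group_add \<Rightarrow> 'a \<Rightarrow> 'a) \<Rightarrow> ('a \<Rightarrow> 'a) \<Rightarrow> 'a \<Rightarrow> 'a \<Rightarrow> 'a \<Rightarrow> 'a" where
  "Hom_associator \<mu> \<alpha> x y z = \<mu> (\<mu> x y) (\<alpha> z) - \<mu> (\<alpha> x) (\<mu> y z)"

lemma (in graded_vector_space) component_homogeneous: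
  assumes "x \<in> gr a"
  shows "component gr x = (\<lambda>b. if b = a then x else 0)"
proof -
  have "{b. (if b = a then x else 0) \<noteq> 0} = (if x = 0 then {} else {a})"
    by auto
  then have "decomposition gr x (\<lambda>b. if b = a then x else 0)"
    using assms subspace_0[OF subspace_gr] by (simp add: decomposition_def)
  then show ?thesis
    unfolding component_def using direct_sum[of x] by (rule the1_equality[rotated])
qed

lemma (in color_nonHom_associative_algebra) color_commutator_homogeneous:
  assumes "x \<in> gr a" "y \<in> gr b"
  shows "color_commutator scale gr \<mu> \<epsilon> x y = \<mu> x y - scale (\<epsilon> a b) (\<mu> y x)"
proof -
  have supp: "{c. (if c = d then u else 0) \<noteq> 0} = (if u = 0 then {} else {d})"
    for d :: 'g and u :: 'a
    by auto
  have zero: "\<mu> 0 u = 0" "\<mu> u 0 = 0" for u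
  proof -
    interpret l: Vector_Spaces.linear scale scale "\<lambda>v. \<mu> v u"
      using mu_even_bilinear by (simp add: even_bilinear_def)
    interpret r: Vector_Spaces.linear scale scale "\<lambda>v. \<mu> u v"
      using mu_even_bilinear by (simp add: even_bilinear_def)
    show "\<mu> 0 u = 0" "\<mu> u 0 = 0" by (rule l.zero, rule r.zero)
  qed
  show ?thesis
    by (simp only: color_commutator_def component_homogeneous[OF assms(1)]
        component_homogeneous[OF assms(2)] supp) (simp add: zero)
qed

end

theory Submission
  imports Defs
begin

text \<open>For homogeneous \<open>x\<close>, \<open>y\<close>, \<open>z\<close> of degrees \<open>a\<close>, \<open>b\<close>, \<open>c\<close> put \<open>p = \<epsilon> a b\<close>, \<open>q = \<epsilon> b c\<close>,
  \<open>r = \<epsilon> c a\<close>. Since \<open>\<epsilon> (a + b) c = q / r\<close>, the term \<open>r [[x,y],\<alpha> z]\<close> expands into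
  \<open>r (xy)(\<alpha> z) - rp (yx)(\<alpha> z) - q (\<alpha> z)(xy) + pq (\<alpha> z)(yx)\<close>, and the cyclic sum of these
  four-term expressions regroups into the six Hom-associators on the right-hand side of the Akivis
  identity. Bilinearity and multiplicativity of the bracket on arbitrary elements hold because
  taking homogeneous components is linear and commutes with \<open>\<alpha>\<close>.\<close>

section \<open>Homogeneous components\<close>

context graded_vector_space
begin

lemma decomposition_component: "decomposition gr x (component gr x)"
  unfolding component_def by (rule theI'[OF direct_sum])

lemma component_in: "component gr x a \<in> gr a"
  using decomposition_component[of x] by (simp add: decomposition_def)

lemma finite_component: "finite {a. component gr x a \<noteq> 0}"
  using decomposition_component[of x] by (simp add: decomposition_def)

text \<open>Indices outside the support contribute \<open>0\<close>. Allowing any finite superset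
  lets elements with different supports share one index set.\<close>

lemma sum_component:
  assumes "finite A" and "{a. component gr x a \<noteq> 0} \<subseteq> A"
  shows "(\<Sum>a\<in>A. component gr x a) = x"
proof -
  have "(\<Sum>a\<in>A. component gr x a) = (\<Sum>a | component gr x a \<noteq> 0. component gr x a)"
    using assms by (intro sum.mono_neutral_right) auto
  then show ?thesis
    using decomposition_component[of x] by (simp add: decomposition_def)
qed

text \<open>This is the uniqueness half of the direct sum. A superset \<open>A\<close> of the
  support suffices, so the exact support of \<open>f\<close> need not be known.\<close>

lemma component_eqI:
  assumes "\<And>a. f a \<in> gr a" and "finite A" and "{a. f a \<noteq> 0} \<subseteq> A" and "x = (\<Sum>a\<in>A. f a)"
  shows "component gr x = f"
proof -
  have "(\<Sum>a\<in>A. f a) = (\<Sum>a | f a \<noteq> 0. f a)"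
    using assms(2,3) by (intro sum.mono_neutral_right) auto
  then have "decomposition gr x f"
    using assms finite_subset[OF assms(3,2)] by (simp add: decomposition_def)
  then show ?thesis
    unfolding component_def using direct_sum[of x] by (rule the1_equality[rotated])
qed

lemma component_add: "component gr (x + y) = (\<lambda>a. component gr x a + component gr y a)"
proof (rule component_eqI)
  \<comment> \<open>Components of \<open>x\<close> and \<open>y\<close> may cancel, so the union can
    exceed the support of \<open>x + y\<close>.\<close>
  let ?A = "{a. component gr x a \<noteq> 0} \<union> {a. component gr y a \<noteq> 0}"
  show "component gr x a + component gr y a \<in> gr a" for a
    by (intro subspace_add subspace_gr component_in)
  show "finite ?A"
    by (simp add: finite_component)
  then show "x + y = (\<Sum>a\<in>?A. component gr x a + component gr y a)"
    by (simp add: sum.distrib sum_component)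
qed auto

text \<open>Since \<open>f\<close> maps each \<open>gr a\<close> into itself, the images of the
  components of \<open>x\<close> already decompose \<open>f x\<close>. It serves both for
  \<open>\<alpha>\<close> and for multiplication by a scalar.\<close>

lemma component_even_linear:
  assumes "even_linear scale gr f"
  shows "component gr (f x) = (\<lambda>a. f (component gr x a))"
proof (rule component_eqI)
  interpret f: Vector_Spaces.linear scale scale f
    using assms by (simp add: even_linear_def)
  let ?A = "{a. component gr x a \<noteq> 0}"
  show "f (component gr x a) \<in> gr a" for a
    using assms component_in by (simp add: even_linear_def)
  show "finite ?A"
    by (rule finite_component)
  then show "f x = (\<Sum>a\<in>?A. f (component gr x a))"
    by (simp flip: f.sum add: sum_component)
  show "{a. f (component gr x a) \<noteq> 0} \<subseteq> ?A"
    by (auto simp: f.zero)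
qed

lemma component_scale: "component gr (scale r x) = (\<lambda>a. scale r (component gr x a))"
  by (rule component_even_linear)
    (simp add: even_linear_def linear_scale_self subspace_scale[OF subspace_gr])

end

section \<open>The color commutator on arbitrary elements\<close>

context color_nonHom_associative_algebra
begin

abbreviation bracket :: "'a \<Rightarrow> 'a \<Rightarrow> 'a"
  where "bracket \<equiv> color_commutator scale gr \<mu> \<epsilon>"

lemma linearI:
  assumes "\<And>x y. f (x + y) = f x + f y" and "\<And>r x. f (scale r x) = scale r (f x)"
  shows "Vector_Spaces.linear scale scale f"
  using assms vector_space_axioms by (simp add: Vector_Spaces.linear_iff)

lemma mu_linear:
  "Vector_Spaces.linear scale scale (\<lambda>x. \<mu> x y)"
  "Vector_Spaces.linear scale scale (\<lambda>y. \<mu> x y)"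
  using mu_even_bilinear by (auto simp: even_bilinear_def)

lemma alpha_linear: "Vector_Spaces.linear scale scale \<alpha>"
  using alpha_even_linear by (simp add: even_linear_def)

lemma mu_add: "\<mu> (x + y) z = \<mu> x z + \<mu> y z" "\<mu> z (x + y) = \<mu> z x + \<mu> z y"
  using mu_linear by (auto simp: Vector_Spaces.linear_iff)

lemma mu_scale: "\<mu> (scale r x) y = scale r (\<mu> x y)" "\<mu> x (scale r y) = scale r (\<mu> x y)"
  using mu_linear by (auto simp: Vector_Spaces.linear_iff)

lemma mu_zero: "\<mu> 0 y = 0" "\<mu> x 0 = 0"
  using mu_scale[of 0 0] mu_scale(2)[of _ 0 0] by auto

lemma mu_diff: "\<mu> (x - y) z = \<mu> x z - \<mu> y z" "\<mu> z (x - y) = \<mu> z x - \<mu> z y"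
  using mu_add(1)[of "x - y" y z] mu_add(2)[of z "x - y" y] by (auto simp: algebra_simps)

lemma alpha_add: "\<alpha> (x + y) = \<alpha> x + \<alpha> y"
  using alpha_linear by (auto simp: Vector_Spaces.linear_iff)

lemma alpha_scale: "\<alpha> (scale r x) = scale r (\<alpha> x)"
  using alpha_linear by (auto simp: Vector_Spaces.linear_iff)

lemma alpha_zero: "\<alpha> 0 = 0"
  using alpha_scale[of 0 0] by simp

lemma alpha_diff: "\<alpha> (x - y) = \<alpha> x - \<alpha> y"
  using alpha_add[of "x - y" y] by (simp add: algebra_simps)

lemma alpha_sum: "\<alpha> (\<Sum>i\<in>I. f i) = (\<Sum>i\<in>I. \<alpha> (f i))"
  by (induction I rule: infinite_finite_induct) (simp_all add: alpha_zero alpha_add)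

lemma mu_in: "x \<in> gr a \<Longrightarrow> y \<in> gr b \<Longrightarrow> \<mu> x y \<in> gr (a + b)"
  using mu_even_bilinear by (auto simp: even_bilinear_def)

lemma alpha_in: "x \<in> gr a \<Longrightarrow> \<alpha> x \<in> gr a"
  using alpha_even_linear by (auto simp: even_linear_def)

lemma component_alpha: "component gr (\<alpha> x) = (\<lambda>a. \<alpha> (component gr x a))"
  by (rule component_even_linear[OF alpha_even_linear])

text \<open>The defining sum runs over exact supports, which change under addition, scaling and
  \<open>\<alpha>\<close>. As \<open>\<mu>\<close> vanishes when an argument is \<open>0\<close>,
  fixed finite supersets give the same value, and later identities can be checked term by
  term.\<close>

lemma bracket_eq_sum:
  assumes "finite A" "{a. component gr x a \<noteq> 0} \<subseteq> A"
    and "finite B" "{b. component gr y b \<noteq> 0} \<subseteq> B"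
  shows "bracket x y = (\<Sum>a\<in>A. \<Sum>b\<in>B. \<mu> (component gr x a) (component gr y b)
           - scale (\<epsilon> a b) (\<mu> (component gr y b) (component gr x a)))"
    (is "_ = (\<Sum>a\<in>A. \<Sum>b\<in>B. ?t a b)")
proof -
  have "(\<Sum>a\<in>A. \<Sum>b\<in>B. ?t a b) = (\<Sum>a\<in>A. \<Sum>b | component gr y b \<noteq> 0. ?t a b)"
    using assms(3,4) by (intro sum.cong refl sum.mono_neutral_right) (auto simp: mu_zero)
  also have "\<dots> = (\<Sum>a | component gr x a \<noteq> 0. \<Sum>b | component gr y b \<noteq> 0. ?t a b)"
    using assms(1,2) by (intro sum.mono_neutral_right) (auto simp: mu_zero)
  finally show ?thesis
    by (simp add: color_commutator_def)
qed

lemma bracket_add_left: "bracket (x + y) z = bracket x z + bracket y z"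
proof -
  let ?A = "{a. component gr x a \<noteq> 0} \<union> {a. component gr y a \<noteq> 0}"
  let ?B = "{b. component gr z b \<noteq> 0}"
  have fin: "finite ?A" "finite ?B"
    by (simp_all add: finite_component)
  have "{a. component gr (x + y) a \<noteq> 0} \<subseteq> ?A"
    by (auto simp: component_add)
  then have "bracket (x + y) z = (\<Sum>a\<in>?A. \<Sum>b\<in>?B. \<mu> (component gr (x + y) a) (component gr z b)
           - scale (\<epsilon> a b) (\<mu> (component gr z b) (component gr (x + y) a)))"
    using fin by (intro bracket_eq_sum) auto
  also have "\<dots> = bracket x z + bracket y z"
    using fin
    by (simp add: bracket_eq_sum[of ?A x ?B z] bracket_eq_sum[of ?A y ?B z] component_add mu_add
        scale_right_distrib add_diff_add sum.distrib)
  finally show ?thesis .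
qed

lemma bracket_add_right: "bracket z (x + y) = bracket z x + bracket z y"
proof -
  let ?B = "{b. component gr x b \<noteq> 0} \<union> {b. component gr y b \<noteq> 0}"
  let ?A = "{a. component gr z a \<noteq> 0}"
  have fin: "finite ?A" "finite ?B"
    by (simp_all add: finite_component)
  have "{b. component gr (x + y) b \<noteq> 0} \<subseteq> ?B"
    by (auto simp: component_add)
  then have "bracket z (x + y) = (\<Sum>a\<in>?A. \<Sum>b\<in>?B. \<mu> (component gr z a) (component gr (x + y) b)
           - scale (\<epsilon> a b) (\<mu> (component gr (x + y) b) (component gr z a)))"
    using fin by (intro bracket_eq_sum) auto
  also have "\<dots> = bracket z x + bracket z y"
    using fin
    by (simp add: bracket_eq_sum[of ?A z ?B x] bracket_eq_sum[of ?A z ?B y] component_add mu_add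
        scale_right_distrib add_diff_add sum.distrib)
  finally show ?thesis .
qed

lemma bracket_scale_left: "bracket (scale r x) y = scale r (bracket x y)"
proof -
  let ?A = "{a. component gr x a \<noteq> 0}" and ?B = "{b. component gr y b \<noteq> 0}"
  \<comment> \<open>For \<open>r = 0\<close> the support of \<open>scale r x\<close> is empty, so
    the support of \<open>x\<close> serves only as a superset.\<close>
  have "bracket (scale r x) y =
      (\<Sum>a\<in>?A. \<Sum>b\<in>?B. \<mu> (component gr (scale r x) a) (component gr y b)
        - scale (\<epsilon> a b) (\<mu> (component gr y b) (component gr (scale r x) a)))"
    by (intro bracket_eq_sum finite_component) (auto simp: component_scale)
  then show ?thesis
    by (simp add: color_commutator_def component_scale mu_scale scale_right_diff_distrib
        scale_sum_right mult.commute)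
qed

lemma bracket_scale_right: "bracket x (scale r y) = scale r (bracket x y)"
proof -
  let ?A = "{a. component gr x a \<noteq> 0}" and ?B = "{b. component gr y b \<noteq> 0}"
  have "bracket x (scale r y) =
      (\<Sum>a\<in>?A. \<Sum>b\<in>?B. \<mu> (component gr x a) (component gr (scale r y) b)
        - scale (\<epsilon> a b) (\<mu> (component gr (scale r y) b) (component gr x a)))"
    by (intro bracket_eq_sum finite_component) (auto simp: component_scale)
  then show ?thesis
    by (simp add: color_commutator_def component_scale mu_scale scale_right_diff_distrib
        scale_sum_right mult.commute)
qed

text \<open>Because \<open>\<alpha>\<close> preserves degrees, the coefficients
  \<open>\<epsilon> a b\<close> agree on both sides. The supports may shrink, since
  \<open>\<alpha>\<close> can kill components.\<close>

lemma bracket_alpha: "bracket (\<alpha> x) (\<alpha> y) = \<alpha> (bracket x y)"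
proof -
  let ?A = "{a. component gr x a \<noteq> 0}" and ?B = "{b. component gr y b \<noteq> 0}"
  have "bracket (\<alpha> x) (\<alpha> y) =
      (\<Sum>a\<in>?A. \<Sum>b\<in>?B. \<mu> (component gr (\<alpha> x) a) (component gr (\<alpha> y) b)
        - scale (\<epsilon> a b) (\<mu> (component gr (\<alpha> y) b) (component gr (\<alpha> x) a)))"
    by (intro bracket_eq_sum finite_component) (auto simp: component_alpha alpha_zero)
  then show ?thesis
    by (simp add: color_commutator_def component_alpha alpha_sum alpha_diff alpha_scale alpha_mu)
qed

section \<open>The axioms of a color Hom-Akivis algebra\<close>

lemma bracket_in:
  assumes "x \<in> gr a" "y \<in> gr b"
  shows "bracket x y \<in> gr (a + b)"
  \<comment> \<open>The swapped product has degree \<open>b + a\<close>, which is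
    \<open>a + b\<close> because the grading group is abelian.\<close>
  using mu_in[OF assms] mu_in[OF assms(2,1)]
  by (simp add: color_commutator_homogeneous[OF assms] add.commute subspace_diff subspace_scale
      subspace_gr)

lemma bracket_even_bilinear: "even_bilinear scale gr bracket"
  unfolding even_bilinear_def
  by (auto intro!: linearI simp: bracket_add_left bracket_add_right bracket_scale_left
      bracket_scale_right bracket_in)

text \<open>After expansion the right-hand side carries \<open>\<mu> x y\<close> with coefficient
  \<open>\<epsilon> a b * \<epsilon> b a = 1\<close>.\<close>

lemma bracket_skew:
  assumes "x \<in> gr a" "y \<in> gr b"
  shows "bracket x y = - scale (\<epsilon> a b) (bracket y x)"
  by (simp add: color_commutator_homogeneous[OF assms] color_commutator_homogeneous[OF assms(2,1)]
      scale_right_diff_distrib mult_swap)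

lemma Hom_associator_even_trilinear: "even_trilinear scale gr (Hom_associator \<mu> \<alpha>)"
proof -
  have "Hom_associator \<mu> \<alpha> x y z \<in> gr (a + b + c)"
    if "x \<in> gr a" "y \<in> gr b" "z \<in> gr c" for a b c x y z
  proof -
    have "\<mu> (\<mu> x y) (\<alpha> z) \<in> gr (a + b + c)" "\<mu> (\<alpha> x) (\<mu> y z) \<in> gr (a + (b + c))"
      using that by (auto intro!: mu_in alpha_in)
    then show ?thesis
      by (simp add: Hom_associator_def subspace_diff subspace_gr add.assoc)
  qed
  then show ?thesis
    unfolding even_trilinear_def
    by (auto intro!: linearI simp: Hom_associator_def mu_add mu_scale alpha_add alpha_scale
        scale_right_diff_distrib)
qed

lemma Hom_associator_alpha:
  "\<alpha> (Hom_associator \<mu> \<alpha> x y z) = Hom_associator \<mu> \<alpha> (\<alpha> x) (\<alpha> y) (\<alpha> z)"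
  by (simp add: Hom_associator_def alpha_diff alpha_mu)

lemma scale_bracket_bracket:
  assumes "x \<in> gr a" "y \<in> gr b" "z \<in> gr c"
  shows "scale (\<epsilon> c a) (bracket (bracket x y) (\<alpha> z)) =
      scale (\<epsilon> c a) (\<mu> (\<mu> x y) (\<alpha> z)) - scale (\<epsilon> c a * \<epsilon> a b) (\<mu> (\<mu> y x) (\<alpha> z))
      - scale (\<epsilon> b c) (\<mu> (\<alpha> z) (\<mu> x y)) + scale (\<epsilon> b c * \<epsilon> a b) (\<mu> (\<alpha> z) (\<mu> y x))"
proof -
  \<comment> \<open>The cyclic weight \<open>\<epsilon> c a\<close> cancels the factor
    \<open>\<epsilon> a c\<close> of \<open>\<epsilon> (a + b) c\<close>.\<close>
  have \<epsilon>: "\<epsilon> c a * \<epsilon> (a + b) c = \<epsilon> b c"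
    using mult_swap[of c a] by (simp add: add_left flip: mult.assoc)
  have "scale (\<epsilon> c a) (bracket (bracket x y) (\<alpha> z)) =
      scale (\<epsilon> c a) (\<mu> (bracket x y) (\<alpha> z))
      - scale (\<epsilon> c a * \<epsilon> (a + b) c) (\<mu> (\<alpha> z) (bracket x y))"
    using color_commutator_homogeneous[OF bracket_in[OF assms(1,2)] alpha_in[OF assms(3)]]
    by (simp add: scale_right_diff_distrib)
  then show ?thesis
    by (simp add: \<epsilon> color_commutator_homogeneous[OF assms(1,2)] mu_diff mu_scale
        scale_right_diff_distrib)
qed

lemma bracket_Akivis_identity:
  assumes "x \<in> gr a" "y \<in> gr b" "z \<in> gr c"
  shows "scale (\<epsilon> c a) (bracket (bracket x y) (\<alpha> z))
      + scale (\<epsilon> a b) (bracket (bracket y z) (\<alpha> x))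
      + scale (\<epsilon> b c) (bracket (bracket z x) (\<alpha> y))
      = scale (\<epsilon> c a) (Hom_associator \<mu> \<alpha> x y z - scale (\<epsilon> a b) (Hom_associator \<mu> \<alpha> y x z))
      + scale (\<epsilon> a b) (Hom_associator \<mu> \<alpha> y z x - scale (\<epsilon> b c) (Hom_associator \<mu> \<alpha> z y x))
      + scale (\<epsilon> b c) (Hom_associator \<mu> \<alpha> z x y - scale (\<epsilon> c a) (Hom_associator \<mu> \<alpha> x z y))"
  \<comment> \<open>The three cyclic shifts of the expansion give twelve terms. They match the two
    terms of each of the six Hom-associators up to the order of scalar factors, so no further law of
    \<open>\<epsilon>\<close> enters.\<close>
  unfolding scale_bracket_bracket[OF assms] scale_bracket_bracket[OF assms(2,3,1)]
    scale_bracket_bracket[OF assms(3,1,2)] Hom_associator_def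
  by (simp add: scale_right_diff_distrib algebra_simps)

end

theorem theorem3p1:
  fixes scale :: "'k::field_char_0 \<Rightarrow> 'a::ab_group_add \<Rightarrow> 'a"
    and gr :: "'g::ab_group_add \<Rightarrow> 'a set"
    and \<mu> :: "'a \<Rightarrow> 'a \<Rightarrow> 'a"
    and \<epsilon> :: "'g \<Rightarrow> 'g \<Rightarrow> 'k"
    and \<alpha> :: "'a \<Rightarrow> 'a"
  assumes "color_nonHom_associative_algebra scale gr \<mu> \<epsilon> \<alpha>"
  shows "multiplicative_color_Hom_Akivis_algebra scale gr
           (color_commutator scale gr \<mu> \<epsilon>) (Hom_associator \<mu> \<alpha>) \<epsilon> \<alpha>"
proof -
  interpret color_nonHom_associative_algebra scale gr \<mu> \<epsilon> \<alpha>
    by (rule assms)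
  show ?thesis
    \<comment> \<open>The interpretation supplies the grading and bicharacter axioms; the bracket,
      the associator, \<open>\<alpha>\<close> and multiplicativity remain.\<close>
    by unfold_locales
      (fact bracket_even_bilinear bracket_skew Hom_associator_even_trilinear alpha_even_linear
        bracket_Akivis_identity bracket_alpha[symmetric] Hom_associator_alpha)+
qed

end
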